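(* There exist a compact connected $F$-space $K$ and a continuous function $f:K\to\mathbb{R}$ such that the set $\Omega_f=\bigcup\{\operatorname{Int} f^{-1}(x):x\in\mathbb{R}\}$ is not dense in $K$.
   Context: Compact spaces are assumed Hausdorff. A (completely regular) space $K$ is an $F$-space if any two disjoint cozero sets of $K$ are completely separated; for compact (more generally normal) $K$ this means that disjoint cozero sets (equivalently, disjoint open $F_\sigma$-sets) have disjoint closures. $\operatorname{Int}$ denotes the interior in $K$, and $f^{-1}(x)=\{p\in K: f(p)=x\}$. *)

theory Defs
  imports "HOL-Analysis.Analysis"
begin

definition cozero_set_of :: "'a topology \<Rightarrow> 'a set \<Rightarrow> bool" where
  "cozero_set_of K U \<longleftrightarrow>
     (\<exists>g. continuous_map K euclideanreal g \<and> U = {p \<in> topspace K. g p \<noteq> 0})"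

definition completely_separated_in :: "'a topology \<Rightarrow> 'a set \<Rightarrow> 'a set \<Rightarrow> bool" where
  "completely_separated_in K A B \<longleftrightarrow>
     A \<subseteq> topspace K \<and> B \<subseteq> topspace K \<and>
     (\<exists>h. continuous_map K (top_of_set {0..1::real}) h \<and> (\<forall>p\<in>A. h p = 0) \<and> (\<forall>p\<in>B. h p = 1))"

definition F_space :: "'a topology \<Rightarrow> bool" where
  "F_space K \<longleftrightarrow>
     completely_regular_space K \<and>
     (\<forall>U V. cozero_set_of K U \<and> cozero_set_of K V \<and> disjnt U V \<longrightarrow>
        completely_separated_in K U V)"

definition Omega :: "'a topology \<Rightarrow> ('a \<Rightarrow> real) \<Rightarrow> 'a set" where
  "Omega K f = (\<Union>x::real. K interior_of {p \<in> topspace K. f p = x})"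

text \<open>HOL cannot quantify existentially over types, so an existence claim for a space has to name
  the type of its points. A space on any type whatsoever witnesses the informal claim. The type
  below has cardinality \<open>2^(2^c)\<close>, hence carries a copy of every space with at most that many
  points, in particular of every subspace of a power of the real line indexed by at most \<open>2^c\<close>
  coordinates. Only the carrier \<open>topspace K\<close> of a topology \<open>K\<close> matters; no topology on the
  type itself is used.\<close>

type_synonym point = "(real \<Rightarrow> real) \<Rightarrow> real"

end

theory Submission imports Defs begin

text \<open>Let the comb have a spine, a copy of the real line, and a hair (another line) attached at every
  point \<open>r\<close> of the spine. The algebra \<open>C\<close> of bounded functions continuous on the spine and on each
  hair yields a compactification, and \<open>K\<close> is the set of cluster points in it of the following
  filter: a property holds eventually if it holds far out on the spine and if, for all but
  countably many \<open>x\<close>, it holds on the whole hair at \<open>r\<close> for all large \<open>r\<close> with \<open>sin r = x\<close>.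
  By Stone--Weierstrass each continuous function on \<open>K\<close> is induced by some \<open>\<phi> \<in> C\<close>. The function
  induced by \<open>r \<cdot> \<phi>\<close>, clamped to \<open>[-1, 1]\<close>, is \<open>1\<close> where \<open>\<phi> > 0\<close> and \<open>-1\<close> where \<open>\<phi> < 0\<close>, because
  \<open>r\<close> tends to infinity along the filter; so \<open>K\<close> is an F-space. It is connected because tails of
  the comb are, with any set of hairs removed. Finally let \<open>f\<close> be induced by \<open>sin r\<close>. If \<open>f\<close> were
  constantly \<open>c\<close> on a nonempty open set of \<open>K\<close> away from the spine, that set would come from a set
  of hair points which for every \<open>m\<close> eventually satisfies \<open>\<bar>sin r - c\<bar> < 1/m\<close>; uniting the countably
  many countable exceptional sets, this set is eventually avoided altogether.\<close>

text \<open>The library has these instances only for countable index types and metric values. Each class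
  needs its own instance command: the arities already declared for \<open>t0_space\<close> and \<open>t1_space\<close> would
  clash with that of \<open>t2_space\<close>.\<close>

instance "fun" :: (type, t0_space) t0_space
proof
  fix f g :: "'a \<Rightarrow> 'b"
  assume "f \<noteq> g"
  then obtain i where i: "f i \<noteq> g i" by (auto simp: fun_eq_iff)
  obtain U where U: "open U" "\<not> (f i \<in> U \<longleftrightarrow> g i \<in> U)" using t0_space_class.t0_space[OF i] by auto
  have "open ((\<lambda>h::'a \<Rightarrow> 'b. h i) -` U)" using U(1) by (rule open_vimage) simp
  then show "\<exists>U. open U \<and> \<not> (f \<in> U \<longleftrightarrow> g \<in> U)" using U(2) by (metis vimage_eq)
qed

instance "fun" :: (type, t1_space) t1_space
proof
  fix f g :: "'a \<Rightarrow> 'b"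
  assume "f \<noteq> g"
  then obtain i where i: "f i \<noteq> g i" by (auto simp: fun_eq_iff)
  obtain U where U: "open U" "f i \<in> U" "g i \<notin> U" using t1_space_class.t1_space[OF i] by auto
  have "open ((\<lambda>h::'a \<Rightarrow> 'b. h i) -` U)" using U(1) by (rule open_vimage) simp
  then show "\<exists>U. open U \<and> f \<in> U \<and> g \<notin> U" using U(2,3) by (metis vimage_eq)
qed

instance "fun" :: (type, t2_space) t2_space
proof
  fix f g :: "'a \<Rightarrow> 'b"
  assume "f \<noteq> g"
  then obtain i where i: "f i \<noteq> g i" by (auto simp: fun_eq_iff)
  obtain U V where UV: "open U" "open V" "f i \<in> U" "g i \<in> V" "U \<inter> V = {}"
    using hausdorff[OF i] by auto
  have "open ((\<lambda>h::'a \<Rightarrow> 'b. h i) -` U)" "open ((\<lambda>h::'a \<Rightarrow> 'b. h i) -` V)"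
    using UV(1,2) by (auto intro: open_vimage)
  then show "\<exists>U V. open U \<and> open V \<and> f \<in> U \<and> g \<in> V \<and> U \<inter> V = {}"
    using UV(3-5) by (intro exI[of _ "(\<lambda>h. h i) -` U"] exI[of _ "(\<lambda>h. h i) -` V"]) auto
qed

section \<open>Auxiliary facts on compactness, filters and uniform limits\<close>

lemma compact_PiE_UNIV:
  fixes B :: "'i \<Rightarrow> 'b::topological_space set"
  assumes "\<And>i. compact (B i)"
  shows "compact (Pi\<^sub>E UNIV B)"
  using assms compactin_PiE[of "\<lambda>_. euclidean" UNIV B] by (simp add: euclidean_product_topology)

lemma Hausdorff_space_euclidean_t2: "Hausdorff_space (euclidean :: 'a::t2_space topology)"
  by (simp add: Hausdorff_space_def disjnt_def) (metis hausdorff)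

lemma compact_Hausdorff_imp_completely_regular_space:
  assumes "compact_space X" "Hausdorff_space X"
  shows "completely_regular_space X"
  using assms by (meson compact_Hausdorff_or_regular_imp_normal_space
      normal_imp_completely_regular_space)

lemma frequently_eventually_contradiction:
  assumes "\<exists>\<^sub>F z in G. P z" "\<forall>\<^sub>F z in G. Q z" "\<And>z. P z \<Longrightarrow> Q z \<Longrightarrow> False"
  shows False
  using assms by (metis (mono_tags, lifting) eventually_mono frequently_def)

definition unit_clamp :: "real \<Rightarrow> real" where
  "unit_clamp t = max (-1) (min 1 t)"

lemma uniform_limit_of_geometric_steps:
  fixes a :: "nat \<Rightarrow> 'x \<Rightarrow> real"
  assumes "\<And>n z. \<bar>a (Suc n) z - a n z\<bar> \<le> (1/2) ^ n"
  obtains l where "uniform_limit UNIV a l sequentially"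
proof -
  have *: "\<bar>a n z - a m z\<bar> \<le> 2 * (1/2)^m" if "m \<le> n" for m n z
  proof -
    \<comment> \<open>The subtracted term closes the induction: a step adds at most
      \<open>(1/2)^n\<close>, exactly the growth of the right-hand side.\<close>
    have "\<bar>a n z - a m z\<bar> \<le> 2 * (1/2)^m - 2 * (1/2)^n"
      using that
    proof (induction n rule: dec_induct)
      case (step n)
      then show ?case using assms[of n z] unfolding power_Suc by linarith
    qed simp
    then show ?thesis by (smt (verit) zero_le_power zero_le_divide_1_iff)
  qed
  have "uniformly_Cauchy_on UNIV a"
  proof (rule uniformly_Cauchy_onI')
    fix e :: real assume "e > 0"
    then obtain M where M: "(1/2)^M < e/2"
      using real_arch_pow_inv[of "e/2" "1/2"] by auto
    have "dist (a m z) (a n z) < e" if "m \<ge> M" "n > m" for m n z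
    proof -
      have "(1/2::real)^m \<le> (1/2)^M" using that by (intro power_decreasing) auto
      then show ?thesis using *[of m n z] M that unfolding dist_real_def by linarith
    qed
    then show "\<exists>M. \<forall>x\<in>UNIV. \<forall>m\<ge>M. \<forall>n>m. dist (a m x) (a n x) < e" by blast
  qed
  then show thesis using that
    by (meson Cauchy_uniformly_convergent uniformly_convergent_on_def)
qed

section \<open>Cluster points of an algebra of functions along a filter\<close>

locale function_compactum =
  fixes C :: "('x \<Rightarrow> real) set" and G :: "'x filter"
  assumes bounded: "\<phi> \<in> C \<Longrightarrow> \<exists>B. \<forall>z. \<bar>\<phi> z\<bar> \<le> B"
    and const: "(\<lambda>_. c) \<in> C"
    and add: "\<phi> \<in> C \<Longrightarrow> \<psi> \<in> C \<Longrightarrow> (\<lambda>z. \<phi> z + \<psi> z) \<in> C"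
    and mult: "\<phi> \<in> C \<Longrightarrow> \<psi> \<in> C \<Longrightarrow> (\<lambda>z. \<phi> z * \<psi> z) \<in> C"
    and comp: "continuous_on UNIV h \<Longrightarrow> \<phi> \<in> C \<Longrightarrow> (\<lambda>z. h (\<phi> z)) \<in> C"
    and lim: "uniform_limit UNIV a \<phi> sequentially \<Longrightarrow> (\<And>n::nat. a n \<in> C) \<Longrightarrow> \<phi> \<in> C"
begin

text \<open>With the default 0 the product can run over all functions: coordinates outside
  \<open>C\<close> are constant, so cluster points are told apart by members of \<open>C\<close>
  alone.\<close>

definition eval :: "'x \<Rightarrow> ('x \<Rightarrow> real) \<Rightarrow> real" where
  "eval z \<phi> = (if \<phi> \<in> C then \<phi> z else 0)"

definition cluster_set :: "(('x \<Rightarrow> real) \<Rightarrow> real) set" where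
  "cluster_set = {p. \<forall>U. open U \<and> p \<in> U \<longrightarrow> (\<exists>\<^sub>F z in G. eval z \<in> U)}"

lemma eval_in [simp]: "\<phi> \<in> C \<Longrightarrow> eval z \<phi> = \<phi> z"
  by (simp add: eval_def)

text \<open>A point outside \<open>F\<close> would have the open neighbourhood \<open>- F\<close>,
  which \<open>eval\<close> eventually avoids. Closed relations that evaluations eventually satisfy
  thereby pass to all cluster points.\<close>

lemma cluster_set_subset_closed:
  assumes "closed F" "\<forall>\<^sub>F z in G. eval z \<in> F"
  shows "cluster_set \<subseteq> F"
proof
  fix p assume p: "p \<in> cluster_set"
  show "p \<in> F"
  proof (rule ccontr)
    assume "p \<notin> F"
    then have "\<exists>\<^sub>F z in G. eval z \<in> - F"
      using p assms(1) by (auto simp: cluster_set_def)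
    then show False using assms(2) by (rule frequently_eventually_contradiction) simp
  qed
qed

lemma closed_cluster_set: "closed cluster_set"
proof -
  have "open (- cluster_set)"
  proof (subst open_subopen, intro ballI)
    fix p assume "p \<in> - cluster_set"
    then obtain U where U: "open U" "p \<in> U" "\<not> (\<exists>\<^sub>F z in G. eval z \<in> U)"
      by (auto simp: cluster_set_def)
    then have "U \<subseteq> - cluster_set" by (auto simp: cluster_set_def)
    then show "\<exists>T. open T \<and> p \<in> T \<and> T \<subseteq> - cluster_set" using U by blast
  qed
  then show ?thesis by (simp add: closed_def)
qed

text \<open>Boundedness confines each coordinate to a compact interval, and Tychonoff's theorem
  makes the product compact.\<close>

lemma eval_box: "\<exists>B. compact B \<and> range eval \<subseteq> B"
proof -
  obtain b where b: "\<bar>\<phi> z\<bar> \<le> b \<phi>" if "\<phi> \<in> C" for \<phi> z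
    using bounded by metis
  define I where "I \<phi> = (if \<phi> \<in> C then {- b \<phi>..b \<phi>} else {0})" for \<phi>
  have "compact (Pi\<^sub>E UNIV I)" by (rule compact_PiE_UNIV) (simp add: I_def)
  moreover have "range eval \<subseteq> Pi\<^sub>E UNIV I"
    using b by (auto simp: eval_def I_def abs_le_iff minus_le_iff)
  ultimately show ?thesis by blast
qed

lemma compact_cluster_set: "compact cluster_set"
proof -
  obtain B where B: "compact B" "range eval \<subseteq> B" using eval_box by blast
  have "cluster_set \<subseteq> B"
    using B by (intro cluster_set_subset_closed compact_imp_closed always_eventually) auto
  then show ?thesis
    using compact_Int_closed[OF B(1) closed_cluster_set] by (simp add: Int_absorb1)
qed

text \<open>This is the passage back from the cluster set to the filter. Each point of the compact
  set \<open>B - U\<close> has a neighbourhood that \<open>eval\<close> eventually avoids, and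
  finitely many of these cover it.\<close>

lemma eventually_eval_in_open:
  assumes "open U" "cluster_set \<subseteq> U"
  shows "\<forall>\<^sub>F z in G. eval z \<in> U"
proof -
  obtain B where B: "compact B" "range eval \<subseteq> B" using eval_box by blast
  have comp: "compact (B - U)" using B(1) assms(1) by (rule compact_diff)
  have "\<forall>p\<in>B - U. \<exists>V. open V \<and> p \<in> V \<and> (\<forall>\<^sub>F z in G. eval z \<notin> V)"
    using assms(2) unfolding cluster_set_def not_frequently[symmetric] by blast
  then obtain V where V: "\<And>p. p \<in> B - U \<Longrightarrow> open (V p) \<and> p \<in> V p \<and> (\<forall>\<^sub>F z in G. eval z \<notin> V p)"
    by metis
  obtain T where T: "T \<subseteq> B - U" "finite T" "B - U \<subseteq> (\<Union>p\<in>T. V p)"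
    using compactE_image[OF comp, of "B - U" V] V by blast
  have "\<forall>\<^sub>F z in G. \<forall>p\<in>T. eval z \<notin> V p"
    using T V by (intro eventually_ball_finite) blast+
  then show ?thesis
    by eventually_elim (use T(3) B(2) in blast)
qed

lemma continuous_on_coordinate: "continuous_on S (\<lambda>p::('x \<Rightarrow> real) \<Rightarrow> real. p \<phi>)"
  by (rule continuous_on_subset[OF continuous_on_product_coordinates subset_UNIV])

lemma closed_coordinate_le:
  fixes g h :: "(('x \<Rightarrow> real) \<Rightarrow> real) \<Rightarrow> real"
  assumes "continuous_on UNIV g" "continuous_on UNIV h" "\<forall>\<^sub>F z in G. g (eval z) \<le> h (eval z)"
    "p \<in> cluster_set"
  shows "g p \<le> h p"
  using cluster_set_subset_closed[OF closed_Collect_le[OF assms(1,2)]] assms(3,4) by (simp add: subset_iff)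

lemma closed_coordinate_eq:
  fixes g h :: "(('x \<Rightarrow> real) \<Rightarrow> real) \<Rightarrow> real"
  assumes "continuous_on UNIV g" "continuous_on UNIV h" "\<And>z. g (eval z) = h (eval z)"
    "p \<in> cluster_set"
  shows "g p = h p"
  using cluster_set_subset_closed[OF closed_Collect_eq[OF assms(1,2)]] assms(3,4) by (simp add: subset_iff)

text \<open>Evaluations respect the operations of \<open>C\<close>, and each such identity is a
  closed condition. By this and the next lemmas every cluster point acts on \<open>C\<close> as a
  ring homomorphism that commutes with continuous functions.\<close>

lemma value_const: "p \<in> cluster_set \<Longrightarrow> p (\<lambda>_. c) = c"
  by (rule closed_coordinate_eq[where g="\<lambda>p. p (\<lambda>_. c)" and h="\<lambda>_. c"])
     (auto intro!: continuous_on_coordinate simp: const)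

lemma value_add:
  "p \<in> cluster_set \<Longrightarrow> \<phi> \<in> C \<Longrightarrow> \<psi> \<in> C \<Longrightarrow> p (\<lambda>z. \<phi> z + \<psi> z) = p \<phi> + p \<psi>"
  by (rule closed_coordinate_eq[where g="\<lambda>p. p (\<lambda>z. \<phi> z + \<psi> z)" and h="\<lambda>p. p \<phi> + p \<psi>"])
     (auto intro!: continuous_on_coordinate continuous_on_add simp: add)

lemma value_mult:
  "p \<in> cluster_set \<Longrightarrow> \<phi> \<in> C \<Longrightarrow> \<psi> \<in> C \<Longrightarrow> p (\<lambda>z. \<phi> z * \<psi> z) = p \<phi> * p \<psi>"
  by (rule closed_coordinate_eq[where g="\<lambda>p. p (\<lambda>z. \<phi> z * \<psi> z)" and h="\<lambda>p. p \<phi> * p \<psi>"])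
     (auto intro!: continuous_on_coordinate continuous_on_mult simp: mult)

lemma value_comp:
  assumes "p \<in> cluster_set" "\<phi> \<in> C" "continuous_on UNIV h"
  shows "p (\<lambda>z. h (\<phi> z)) = h (p \<phi>)"
proof (rule closed_coordinate_eq[OF continuous_on_coordinate _ _ assms(1)])
  show "continuous_on UNIV (\<lambda>p::('x \<Rightarrow> real) \<Rightarrow> real. h (p \<phi>))"
    by (rule continuous_on_compose2[OF assms(3) continuous_on_coordinate]) simp
  show "eval z (\<lambda>z. h (\<phi> z)) = h (eval z \<phi>)" for z
    by (simp add: assms(2) comp[OF assms(3,2)])
qed

lemma value_outside: "p \<in> cluster_set \<Longrightarrow> \<phi> \<notin> C \<Longrightarrow> p \<phi> = 0"
  by (rule closed_coordinate_eq[where g="\<lambda>p. p \<phi>" and h="\<lambda>_. 0"]) (auto intro!: continuous_on_coordinate simp: eval_def)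

lemma diff: "\<phi> \<in> C \<Longrightarrow> \<psi> \<in> C \<Longrightarrow> (\<lambda>z. \<phi> z - \<psi> z) \<in> C"
  using add[of \<phi> "\<lambda>z. - \<psi> z"] comp[of uminus \<psi>] by (simp add: continuous_on_minus)

lemma value_diff:
  "p \<in> cluster_set \<Longrightarrow> \<phi> \<in> C \<Longrightarrow> \<psi> \<in> C \<Longrightarrow> p (\<lambda>z. \<phi> z - \<psi> z) = p \<phi> - p \<psi>"
  by (rule closed_coordinate_eq[where g="\<lambda>p. p (\<lambda>z. \<phi> z - \<psi> z)" and h="\<lambda>p. p \<phi> - p \<psi>"])
     (auto intro!: continuous_on_coordinate continuous_on_diff simp: diff)

section \<open>Representation of continuous functions by members of \<open>C\<close>\<close>

lemma approximation:
  assumes "continuous_on cluster_set F" "e > 0"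
  shows "\<exists>\<phi>\<in>C. \<forall>p\<in>cluster_set. \<bar>F p - p \<phi>\<bar> < e"
proof -
  define R where "R = {g. continuous_on cluster_set g \<and> (\<exists>\<phi>\<in>C. \<forall>p\<in>cluster_set. g p = p \<phi>)}"
  interpret function_ring_on R cluster_set
  proof
    show "compact cluster_set" by (rule compact_cluster_set)
    show "continuous_on cluster_set g" if "g \<in> R" for g using that by (simp add: R_def)
    show "(\<lambda>p. g p + h p) \<in> R" if gh: "g \<in> R" "h \<in> R" for g h
    proof -
      obtain \<phi> where \<phi>: "\<phi> \<in> C" "\<forall>p\<in>cluster_set. g p = p \<phi>" using gh(1) by (auto simp: R_def)
      obtain \<psi> where \<psi>: "\<psi> \<in> C" "\<forall>p\<in>cluster_set. h p = p \<psi>" using gh(2) by (auto simp: R_def)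
      have "\<forall>p\<in>cluster_set. g p + h p = p (\<lambda>z. \<phi> z + \<psi> z)"
        using \<phi> \<psi> by (simp add: value_add)
      moreover have "continuous_on cluster_set (\<lambda>p. g p + h p)"
        using gh by (auto simp: R_def intro: continuous_on_add)
      ultimately show ?thesis using add[OF \<phi>(1) \<psi>(1)] unfolding R_def by blast
    qed
    show "(\<lambda>p. g p * h p) \<in> R" if gh: "g \<in> R" "h \<in> R" for g h
    proof -
      obtain \<phi> where \<phi>: "\<phi> \<in> C" "\<forall>p\<in>cluster_set. g p = p \<phi>" using gh(1) by (auto simp: R_def)
      obtain \<psi> where \<psi>: "\<psi> \<in> C" "\<forall>p\<in>cluster_set. h p = p \<psi>" using gh(2) by (auto simp: R_def)
      have "\<forall>p\<in>cluster_set. g p * h p = p (\<lambda>z. \<phi> z * \<psi> z)"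
        using \<phi> \<psi> by (simp add: value_mult)
      moreover have "continuous_on cluster_set (\<lambda>p. g p * h p)"
        using gh by (auto simp: R_def intro: continuous_on_mult)
      ultimately show ?thesis using mult[OF \<phi>(1) \<psi>(1)] unfolding R_def by blast
    qed
    show "(\<lambda>_. c) \<in> R" for c
      using const value_const by (auto simp: R_def) metis
    show "\<exists>f\<in>R. f p \<noteq> f q" if pq: "p \<in> cluster_set" "q \<in> cluster_set" "p \<noteq> q" for p q
    proof -
      obtain \<phi> where \<phi>: "p \<phi> \<noteq> q \<phi>" using pq(3) by (auto simp: fun_eq_iff)
      \<comment> \<open>Both points vanish at coordinates outside \<open>C\<close>, so a separating
        coordinate belongs to \<open>C\<close>.\<close>
      then have "\<phi> \<in> C" using value_outside[OF pq(1), of \<phi>] value_outside[OF pq(2), of \<phi>] by fastforce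
      then have "(\<lambda>p. p \<phi>) \<in> R"
        unfolding R_def by (intro CollectI conjI bexI[of _ \<phi>] ballI refl continuous_on_coordinate)
      then show ?thesis using \<phi> by (intro bexI[of _ "\<lambda>p. p \<phi>"])
    qed
  qed
  obtain g where g: "g \<in> R" "\<forall>x\<in>cluster_set. \<bar>F x - g x\<bar> < e"
    using Stone_Weierstrass_basic[OF assms] by blast
  then obtain \<phi> where "\<phi> \<in> C" "\<forall>p\<in>cluster_set. g p = p \<phi>" by (auto simp: R_def)
  with g(2) show ?thesis by (intro bexI[of _ \<phi>]) simp_all
qed

text \<open>Closure of \<open>C\<close> under uniform limits turns approximation into equality, once
  the approximants are modified so as to converge uniformly on all of \<open>'x\<close>.\<close>

lemma continuous_function_representation:
  assumes F: "continuous_on cluster_set F"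
  obtains \<phi> where "\<phi> \<in> C" "\<And>p. p \<in> cluster_set \<Longrightarrow> p \<phi> = F p"
proof -
  \<comment> \<open>With error \<open>(1/2)^n/2\<close>, consecutive approximants differ at cluster
    points by less than 3/4 of \<open>(1/2)^n\<close>, which is within the clamping bound of
    \<open>cl n\<close>.\<close>
  obtain \<psi> where \<psi>: "\<And>n. \<psi> n \<in> C" "\<And>n p. p \<in> cluster_set \<Longrightarrow> \<bar>F p - p (\<psi> n)\<bar> < (1/2)^n/2"
    using approximation[OF F, of "(1/2)^n/2" for n] by (simp add: Bex_def) metis
  define cl where "cl n t = max (- ((1/2)^n)) (min ((1/2)^n) t)" for n :: nat and t :: real
  have cl_cont: "continuous_on UNIV (cl n)" for n unfolding cl_def by (intro continuous_intros)
  \<comment> \<open>Clamping the increments makes the approximants converge uniformly on the whole index space,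
    not only on the cluster set, where the clamping has no effect.\<close>
  define a where "a = rec_nat (\<psi> 0) (\<lambda>n u z. u z + cl n (\<psi> (Suc n) z - u z))"
  have a0: "a 0 = \<psi> 0" and aS: "a (Suc n) = (\<lambda>z. a n z + cl n (\<psi> (Suc n) z - a n z))" for n
    by (simp_all add: a_def)
  have aC: "a n \<in> C" for n
    by (induction n) (auto simp: a0 aS \<psi> intro!: add comp[OF cl_cont] diff)
  have val: "p (a n) = p (\<psi> n)" if p: "p \<in> cluster_set" for n p
  proof (induction n)
    case (Suc n)
    have "p (a (Suc n)) = p (a n) + cl n (p (\<psi> (Suc n)) - p (a n))"
      unfolding aS by (simp add: aC \<psi>(1) value_add[OF p] value_comp[OF p _ cl_cont] value_diff[OF p] diff comp[OF cl_cont])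
    moreover have "\<bar>p (\<psi> (Suc n)) - p (\<psi> n)\<bar> \<le> (1/2)^n"
      using \<psi>(2)[OF p, of n] \<psi>(2)[OF p, of "Suc n"] unfolding power_Suc by linarith
    ultimately show ?case using Suc by (auto simp: cl_def)
  qed (simp add: a0)
  have "\<bar>a (Suc n) z - a n z\<bar> \<le> (1/2) ^ n" for n z
    unfolding aS cl_def using zero_le_power[of "1/2::real" n] by linarith
  then obtain \<phi> where lim\<phi>: "uniform_limit UNIV a \<phi> sequentially"
    using uniform_limit_of_geometric_steps by blast
  have \<phi>C: "\<phi> \<in> C" using lim[OF lim\<phi> aC] .
  have "p \<phi> = F p" if p: "p \<in> cluster_set" for p
  proof -
    have "(\<lambda>n. p (a n)) \<longlonglongrightarrow> p \<phi>"
    proof (rule tendstoI)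
      fix e :: real assume e: "e > 0"
      have "\<forall>\<^sub>F n in sequentially. \<forall>z. dist (a n z) (\<phi> z) < e/2"
        using uniform_limitD[OF lim\<phi>, of "e/2"] e by simp
      then show "\<forall>\<^sub>F n in sequentially. dist (p (a n)) (p \<phi>) < e"
      proof eventually_elim
        case (elim n)
        have "\<bar>p (a n) - p \<phi>\<bar> \<le> e/2"
        proof (rule closed_coordinate_le[where g = "\<lambda>p. \<bar>p (a n) - p \<phi>\<bar>" and h = "\<lambda>_. e/2"])
          show "\<forall>\<^sub>F z in G. \<bar>eval z (a n) - eval z \<phi>\<bar> \<le> e/2"
            using elim by (simp add: aC \<phi>C dist_real_def less_imp_le)
        qed (auto intro!: continuous_intros continuous_on_coordinate p)
        then show ?case using e by (simp add: dist_real_def)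
      qed
    qed
    moreover have "(\<lambda>n. p (a n)) \<longlonglongrightarrow> F p"
    proof (rule tendstoI)
      fix e :: real assume e: "e > 0"
      have "(\<lambda>n. (1/2::real)^n/2) \<longlonglongrightarrow> 0/2" by (intro tendsto_intros) auto
      then have "\<forall>\<^sub>F n in sequentially. (1/2::real)^n/2 < e"
        using e by (intro order_tendstoD) auto
      then show "\<forall>\<^sub>F n in sequentially. dist (p (a n)) (F p) < e"
      proof eventually_elim
        case (elim n)
        then show ?case
          using \<psi>(2)[OF p, of n] unfolding dist_real_def val[OF p] by linarith
      qed
    qed
    ultimately show ?thesis by (rule LIMSEQ_unique)
  qed
  then show thesis using that \<phi>C by blast
qed

section \<open>Connectedness\<close>

lemma frequently_near:
  assumes p: "p \<in> cluster_set" and "open U" "p \<in> U"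
  shows "\<exists>\<^sub>F z in G. eval z \<in> U"
  using assms by (auto simp: cluster_set_def)

lemma open_coordinate_less:
  "open {q::('x \<Rightarrow> real) \<Rightarrow> real. c < q \<phi>}" "open {q::('x \<Rightarrow> real) \<Rightarrow> real. q \<phi> < c}"
  by (auto intro!: open_Collect_less continuous_on_coordinate continuous_intros)

text \<open>A separation gives a continuous function with values 0 and 1, represented by some \<phi>
  in \<open>C\<close>. Eventually \<phi> avoids the middle third, so \<open>gap\<close> puts it on
  one side, although both values are attained at cluster points.\<close>

lemma connected_cluster_set:
  assumes gap: "\<And>\<phi>. \<phi> \<in> C \<Longrightarrow> \<forall>\<^sub>F z in G. \<phi> z < 1/3 \<or> 2/3 < \<phi> z \<Longrightarrow>
      (\<forall>\<^sub>F z in G. \<phi> z < 1/3) \<or> (\<forall>\<^sub>F z in G. 2/3 < \<phi> z)"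
  shows "connected cluster_set"
proof (rule ccontr)
  assume "\<not> connected cluster_set"
  then obtain A B where AB: "closed A" "closed B" "cluster_set \<subseteq> A \<union> B" "A \<inter> B \<inter> cluster_set = {}"
     "A \<inter> cluster_set \<noteq> {}" "B \<inter> cluster_set \<noteq> {}"
    by (auto simp: connected_closed)
  define F :: "(('x \<Rightarrow> real) \<Rightarrow> real) \<Rightarrow> real" where "F p = (if p \<in> A then 0 else 1)" for p
  have "continuous_on ((cluster_set \<inter> A) \<union> (cluster_set \<inter> B)) F"
    unfolding F_def
    by (rule continuous_on_cases) (use AB closed_cluster_set in auto)
  moreover have "(cluster_set \<inter> A) \<union> (cluster_set \<inter> B) = cluster_set" using AB by auto
  ultimately have "continuous_on cluster_set F" by simp
  then obtain \<phi> where \<phi>: "\<phi> \<in> C" "\<And>p. p \<in> cluster_set \<Longrightarrow> p \<phi> = F p"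
    using continuous_function_representation by blast
  have "\<forall>\<^sub>F z in G. eval z \<in> {q. q \<phi> < 1/3} \<union> {q. 2/3 < q \<phi>}"
    by (intro eventually_eval_in_open open_Un open_coordinate_less) (auto simp: \<phi> F_def split: if_splits)
  then have "(\<forall>\<^sub>F z in G. \<phi> z < 1/3) \<or> (\<forall>\<^sub>F z in G. 2/3 < \<phi> z)"
    using gap[OF \<phi>(1)] by (simp add: \<phi>(1))
  moreover obtain p q where "p \<in> cluster_set" "p \<in> A" "q \<in> cluster_set" "q \<notin> A" using AB by blast
  then have pq: "p \<in> cluster_set" "p \<phi> = 0" "q \<in> cluster_set" "q \<phi> = 1" using \<phi>(2)[of p] \<phi>(2)[of q] by (simp_all add: F_def)
  moreover have "\<exists>\<^sub>F z in G. eval z \<in> {q. q \<phi> < 1/3}"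
    using pq by (intro frequently_near[of p] open_coordinate_less) auto
  moreover have "\<exists>\<^sub>F z in G. eval z \<in> {q. 2/3 < q \<phi>}"
    using pq by (intro frequently_near[of q] open_coordinate_less) auto
  ultimately show False
    using frequently_eventually_contradiction[of "\<lambda>z. \<phi> z < 1/3" G "\<lambda>z. 2/3 < \<phi> z"]
      frequently_eventually_contradiction[of "\<lambda>z. 2/3 < \<phi> z" G "\<lambda>z. \<phi> z < 1/3"]
    by (auto simp: \<phi>(1))
qed

section \<open>The F-space property\<close>

lemma completely_regular_space_cluster_set: "completely_regular_space (top_of_set cluster_set)"
  by (rule compact_Hausdorff_imp_completely_regular_space)
    (simp_all add: compact_space_subtopology compact_cluster_set Hausdorff_space_subtopology
      Hausdorff_space_euclidean_t2)

text \<open>The function \<nu> may be unbounded and lie outside \<open>C\<close>; only its clamped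
  products have to be members. They act as a sign function for \<phi> at cluster points.\<close>

lemma F_space_cluster_set:
  assumes clamp: "\<And>\<phi>. \<phi> \<in> C \<Longrightarrow> (\<lambda>z. unit_clamp (\<nu> z * \<phi> z)) \<in> C"
    and \<nu>: "filterlim \<nu> at_top G"
  shows "F_space (top_of_set cluster_set)"
  unfolding F_space_def
proof (intro conjI allI impI)
  show "completely_regular_space (top_of_set cluster_set)"
    by (rule completely_regular_space_cluster_set)
  fix U V
  assume UV: "cozero_set_of (top_of_set cluster_set) U \<and> cozero_set_of (top_of_set cluster_set) V \<and> disjnt U V"
  have "\<exists>g. continuous_on cluster_set g \<and> U = {p \<in> cluster_set. g p \<noteq> (0::real)}"
    "\<exists>h. continuous_on cluster_set h \<and> V = {p \<in> cluster_set. h p \<noteq> (0::real)}"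
    using UV[THEN conjunct1] UV[THEN conjunct2, THEN conjunct1] by (simp_all add: cozero_set_of_def)
  then obtain g h :: "_ \<Rightarrow> real" where g: "continuous_on cluster_set g" and U: "U = {p \<in> cluster_set. g p \<noteq> 0}"
    and h: "continuous_on cluster_set h" and V: "V = {p \<in> cluster_set. h p \<noteq> 0}"
    by (elim exE conjE)
  \<comment> \<open>By disjointness \<open>h\<close> vanishes on \<open>U\<close> and
    \<open>g\<close> on \<open>V\<close>, so the sign of this difference tells the two sets
    apart.\<close>
  have "continuous_on cluster_set (\<lambda>p. \<bar>g p\<bar> - \<bar>h p\<bar>)" using g h by (intro continuous_intros)
  then obtain \<phi> where \<phi>: "\<phi> \<in> C" "\<And>p. p \<in> cluster_set \<Longrightarrow> p \<phi> = \<bar>g p\<bar> - \<bar>h p\<bar>"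
    using continuous_function_representation by blast
  have posU: "p \<phi> > 0" if "p \<in> U" for p
    using that UV \<phi>(2)[of p] unfolding U V disjnt_def by auto
  have negV: "p \<phi> < 0" if "p \<in> V" for p
    using that UV \<phi>(2)[of p] unfolding U V disjnt_def by auto
  define k where "k = (\<lambda>z. unit_clamp (\<nu> z * \<phi> z))"
  have k: "k \<in> C" unfolding k_def by (rule clamp[OF \<phi>(1)])
  have bound: "\<bar>p k\<bar> \<le> 1" if "p \<in> cluster_set" for p
    by (rule closed_coordinate_le[where g="\<lambda>p. \<bar>p k\<bar>" and h="\<lambda>_. 1"])
      (use that k in \<open>auto intro!: continuous_intros continuous_on_coordinate always_eventually simp: k_def unit_clamp_def\<close>)
  have k1: "p k = 1" if p: "p \<in> cluster_set" "p \<phi> > 0" for p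
  proof (rule ccontr)
    assume "p k \<noteq> 1"
    \<comment> \<open>Halving \<open>p \<phi>\<close> gives an open condition around
      \<open>p\<close>. Where it holds and \<nu> is at least \<open>2 / p \<phi>\<close>, the
      product is at least 1 and the clamp equals 1.\<close>
    then have "p \<in> {q. p \<phi> / 2 < q \<phi>} \<inter> {q. q k < 1}" using p bound[of p] by auto
    then have "\<exists>\<^sub>F z in G. eval z \<in> {q. p \<phi> / 2 < q \<phi>} \<inter> {q. q k < 1}"
      using p by (intro frequently_near open_Int open_coordinate_less)
    moreover have "\<forall>\<^sub>F z in G. 2 / p \<phi> \<le> \<nu> z" using \<nu> by (simp add: filterlim_at_top)
    ultimately show False
    proof (rule frequently_eventually_contradiction)
      fix z assume z: "eval z \<in> {q. p \<phi> / 2 < q \<phi>} \<inter> {q. q k < 1}" "2 / p \<phi> \<le> \<nu> z"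
      have "1 = (2 / p \<phi>) * (p \<phi> / 2)" using p by simp
      also have "\<dots> \<le> \<nu> z * \<phi> z"
      proof (rule mult_mono)
        show "p \<phi> / 2 \<le> \<phi> z" using z \<phi>(1) by simp
        have "0 \<le> 2 / p \<phi>" using p by simp
        then show "0 \<le> \<nu> z" using z(2) by linarith
      qed (use z p in auto)
      finally show False using z k by (auto simp: k_def unit_clamp_def)
    qed
  qed
  have k2: "p k = -1" if p: "p \<in> cluster_set" "p \<phi> < 0" for p
  proof (rule ccontr)
    assume "p k \<noteq> -1"
    then have "p \<in> {q. q \<phi> < p \<phi> / 2} \<inter> {q. -1 < q k}" using p bound[of p] by auto
    then have "\<exists>\<^sub>F z in G. eval z \<in> {q. q \<phi> < p \<phi> / 2} \<inter> {q. -1 < q k}"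
      using p by (intro frequently_near open_Int open_coordinate_less)
    moreover have "\<forall>\<^sub>F z in G. 2 / - p \<phi> \<le> \<nu> z" using \<nu> by (simp add: filterlim_at_top)
    ultimately show False
    proof (rule frequently_eventually_contradiction)
      fix z assume z: "eval z \<in> {q. q \<phi> < p \<phi> / 2} \<inter> {q. -1 < q k}" "2 / - p \<phi> \<le> \<nu> z"
      have "1 = (2 / - p \<phi>) * (- p \<phi> / 2)" using p by simp
      also have "\<dots> \<le> \<nu> z * - \<phi> z"
      proof (rule mult_mono)
        show "- p \<phi> / 2 \<le> - \<phi> z" using z \<phi>(1) by simp
        have "0 \<le> 2 / - p \<phi>" using p by (intro divide_nonneg_nonneg) auto
        then show "0 \<le> \<nu> z" using z(2) by linarith
      qed (use z p in auto)
      finally show False using z k by (auto simp: k_def unit_clamp_def)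
    qed
  qed
  define s where "s p = (1 - p k) / 2" for p :: "('x \<Rightarrow> real) \<Rightarrow> real"
  have "continuous_map (top_of_set cluster_set) (top_of_set {0..1}) s"
    using bound unfolding s_def
    by (auto simp: continuous_map_in_subtopology abs_le_iff minus_le_iff intro!: continuous_intros continuous_on_coordinate)
  moreover have "\<forall>p\<in>U. s p = 0" "\<forall>p\<in>V. s p = 1"
    using k1 k2 posU negV by (auto simp: s_def U V)
  ultimately show "completely_separated_in (top_of_set cluster_set) U V"
    unfolding completely_separated_in_def U V by auto
qed

section \<open>Points outside the closure of \<open>Omega\<close>\<close>

text \<open>The function \<tau> stands for the distance from the spine. If \<open>p\<close> were in
  \<open>Omega\<close>, a bump function \<phi> at \<open>p\<close>, supported where \<open>f\<close>
  is \<open>c\<close> and \<tau> exceeds 1/2, would make the property \<open>1/2 < \<phi> z\<close>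
  satisfy the premises of \<open>small\<close>, while it holds frequently.\<close>

lemma Omega_avoids:
  assumes f: "f \<in> C" and \<tau>: "\<tau> \<in> C"
    and small: "\<And>P c. (\<And>e. e > 0 \<Longrightarrow> \<forall>\<^sub>F z in G. P z \<longrightarrow> \<bar>f z - c\<bar> < e) \<Longrightarrow>
        \<forall>\<^sub>F z in G. P z \<longrightarrow> \<tau> z > 0 \<Longrightarrow> \<forall>\<^sub>F z in G. \<not> P z"
    and p: "p \<in> cluster_set" "p \<tau> > 1/2"
  shows "p \<notin> Omega (top_of_set cluster_set) (\<lambda>p. p f)"
proof
  assume "p \<in> Omega (top_of_set cluster_set) (\<lambda>p. p f)"
  then obtain c W where W: "openin (top_of_set cluster_set) W" "p \<in> W" "\<And>q. q \<in> W \<Longrightarrow> q f = c"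
    unfolding Omega_def interior_of_def by auto
  then obtain O' where O': "open O'" "W = cluster_set \<inter> O'" by (auto simp: openin_open)
  define S where "S = cluster_set - (O' \<inter> {q. 1/2 < q \<tau>})"
  have S: "closedin (top_of_set cluster_set) S"
    unfolding S_def Diff_eq using O'(1) open_coordinate_less
    by (intro closedin_closed_Int closed_Compl open_Int)
  have "completely_regular_space (top_of_set cluster_set)"
    by (rule completely_regular_space_cluster_set)
  moreover have "p \<in> topspace (top_of_set cluster_set) - S" using p W O' by (auto simp: S_def)
  ultimately obtain g :: "(('x \<Rightarrow> real) \<Rightarrow> real) \<Rightarrow> real"
    where g: "continuous_map (top_of_set cluster_set) (top_of_set {0..1}) g" "g p = 0" "g ` S \<subseteq> {1}"
    using S unfolding completely_regular_space_def by metis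
  have "continuous_on cluster_set (\<lambda>q. 1 - g q)"
    using g(1) by (auto simp: continuous_map_in_subtopology intro!: continuous_intros)
  then obtain \<phi> where \<phi>: "\<phi> \<in> C" "\<And>q. q \<in> cluster_set \<Longrightarrow> q \<phi> = 1 - g q"
    using continuous_function_representation by blast
  have supp: "q \<phi> = 0 \<or> (q f = c \<and> 1/2 < q \<tau>)" if "q \<in> cluster_set" for q
    using that g(3) W(3) O' \<phi>(2)[OF that] by (auto simp: S_def)
  have "\<forall>\<^sub>F z in G. \<not> 1/2 < \<phi> z"
  proof (rule small[where c=c])
    fix e :: real assume e: "e > 0"
    \<comment> \<open>By \<open>supp\<close> these open sets cover the cluster set: at each of its
      points \<phi> vanishes or \<open>f\<close> takes the value \<open>c\<close>.\<close>
    have "\<forall>\<^sub>F z in G. eval z \<in> {q. q \<phi> < 1/2} \<union> ({q. q f < c + e} \<inter> {q. c - e < q f})"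
      by (intro eventually_eval_in_open open_Un open_Int open_coordinate_less)
        (use supp e in fastforce)
    then show "\<forall>\<^sub>F z in G. 1/2 < \<phi> z \<longrightarrow> \<bar>f z - c\<bar> < e"
      by eventually_elim (use f \<phi>(1) in auto)
  next
    have "\<forall>\<^sub>F z in G. eval z \<in> {q. q \<phi> < 1/2} \<union> {q. 0 < q \<tau>}"
      by (intro eventually_eval_in_open open_Un open_coordinate_less)
        (use supp in fastforce)
    then show "\<forall>\<^sub>F z in G. 1/2 < \<phi> z \<longrightarrow> \<tau> z > 0"
      by eventually_elim (use \<tau> \<phi>(1) in auto)
  qed
  moreover have "\<exists>\<^sub>F z in G. eval z \<in> {q. 1/2 < q \<phi>}"
    using p \<phi>(2)[OF p(1)] g(2) by (intro frequently_near[OF p(1)] open_coordinate_less) auto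
  ultimately show False
    using frequently_eventually_contradiction[of "\<lambda>z. 1/2 < \<phi> z" G "\<lambda>z. \<not> 1/2 < \<phi> z"] by (simp add: \<phi>(1))
qed

text \<open>The open set where \<tau> exceeds 1/2 misses \<open>Omega\<close>. It is nonempty, since
  otherwise \<tau> would eventually be below 1, against \<open>freq\<close>.\<close>

lemma closure_Omega_neq:
  assumes f: "f \<in> C" and \<tau>: "\<tau> \<in> C"
    and small: "\<And>P c. (\<And>e. e > 0 \<Longrightarrow> \<forall>\<^sub>F z in G. P z \<longrightarrow> \<bar>f z - c\<bar> < e) \<Longrightarrow>
        \<forall>\<^sub>F z in G. P z \<longrightarrow> \<tau> z > 0 \<Longrightarrow> \<forall>\<^sub>F z in G. \<not> P z"
    and freq: "\<exists>\<^sub>F z in G. \<tau> z \<ge> 1"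
  shows "top_of_set cluster_set closure_of Omega (top_of_set cluster_set) (\<lambda>p. p f) \<noteq> cluster_set"
proof -
  obtain p where p: "p \<in> cluster_set" "p \<tau> > 1/2"
  proof (rule ccontr)
    assume "\<not> thesis"
    then have "cluster_set \<subseteq> {q. q \<tau> < 1}" using that by force
    then have "\<forall>\<^sub>F z in G. eval z \<in> {q. q \<tau> < 1}"
      by (intro eventually_eval_in_open open_coordinate_less)
    with freq show False by (rule frequently_eventually_contradiction) (use \<tau> in auto)
  qed
  define W where "W = cluster_set \<inter> {q. 1/2 < q \<tau>}"
  have "openin (top_of_set cluster_set) W"
    unfolding W_def by (intro openin_open_Int open_coordinate_less)
  moreover have "p \<in> W" using p by (simp add: W_def)
  moreover have "q \<notin> Omega (top_of_set cluster_set) (\<lambda>p. p f)" if "q \<in> W" for q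
  proof (rule Omega_avoids[OF f \<tau>])
    show "\<forall>\<^sub>F z in G. \<not> P z" if "\<And>e. e > 0 \<Longrightarrow> \<forall>\<^sub>F z in G. P z \<longrightarrow> \<bar>f z - c\<bar> < e"
      "\<forall>\<^sub>F z in G. P z \<longrightarrow> \<tau> z > 0" for P c
      using that by (rule small)
  qed (use that in \<open>auto simp: W_def\<close>)
  ultimately have "p \<notin> top_of_set cluster_set closure_of Omega (top_of_set cluster_set) (\<lambda>p. p f)"
    unfolding in_closure_of by blast
  then show ?thesis using p by blast
qed

end

section \<open>The comb and its filter\<close>

text \<open>The value \<open>b (r, s)\<close> codes the point at height \<open>s\<close> on the hair
  at \<open>r\<close>; the spine is \<open>s = 0\<close>. No continuity is asked across hairs away
  from the spine, and outside the range of \<open>b\<close> only boundedness is required.\<close>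

definition comb_functions :: "(real \<times> real \<Rightarrow> 'x) \<Rightarrow> ('x \<Rightarrow> real) set" where
  "comb_functions b = {\<phi>. (\<exists>B. \<forall>z. \<bar>\<phi> z\<bar> \<le> B) \<and> continuous_on UNIV (\<lambda>r. \<phi> (b (r, 0))) \<and>
     (\<forall>r. continuous_on UNIV (\<lambda>s. \<phi> (b (r, s))))}"

definition comb_filter :: "(real \<times> real) filter" where
  "comb_filter = Abs_filter (\<lambda>P. (\<forall>\<^sub>F r in at_top. P (r, 0)) \<and>
     (\<exists>E. countable E \<and> (\<forall>x. x \<notin> E \<longrightarrow> (\<forall>\<^sub>F r in at_top. sin r = x \<longrightarrow> (\<forall>s. P (r, s))))))"

text \<open>The condition given to \<open>Abs_filter\<close> defines a filter because the union of
  two countable exceptional sets is countable.\<close>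

lemma eventually_comb_filter:
  "eventually P comb_filter \<longleftrightarrow> (\<forall>\<^sub>F r in at_top. P (r, 0)) \<and>
     (\<exists>E. countable E \<and> (\<forall>x. x \<notin> E \<longrightarrow> (\<forall>\<^sub>F r in at_top. sin r = x \<longrightarrow> (\<forall>s. P (r, s)))))"
  unfolding comb_filter_def
proof (rule eventually_Abs_filter, rule is_filter.intro, goal_cases)
  case 1
  show ?case by auto
next
  case (2 P Q)
  then obtain E F where E: "countable E" "\<And>x. x \<notin> E \<Longrightarrow> \<forall>\<^sub>F r in at_top. sin r = x \<longrightarrow> (\<forall>s. P (r, s))"
    and F: "countable F" "\<And>x. x \<notin> F \<Longrightarrow> \<forall>\<^sub>F r in at_top. sin r = x \<longrightarrow> (\<forall>s. Q (r, s))"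
    by blast
  have "\<forall>\<^sub>F r in at_top. sin r = x \<longrightarrow> (\<forall>s. P (r, s) \<and> Q (r, s))" if "x \<notin> E \<union> F" for x
    using E(2)[of x] F(2)[of x] that by (auto elim: eventually_elim2)
  moreover have "\<forall>\<^sub>F r in at_top. P (r, 0) \<and> Q (r, 0)" using 2 by (simp add: eventually_conj)
  ultimately show ?case using E(1) F(1) by (intro conjI exI[of _ "E \<union> F"]) auto
next
  case (3 P Q)
  then obtain E where E: "countable E" "\<And>x. x \<notin> E \<Longrightarrow> \<forall>\<^sub>F r in at_top. sin r = x \<longrightarrow> (\<forall>s. P (r, s))"
    by blast
  have "\<forall>\<^sub>F r in at_top. sin r = x \<longrightarrow> (\<forall>s. Q (r, s))" if "x \<notin> E" for x
    using E(2)[OF that] by eventually_elim (use 3 in auto)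
  moreover have "\<forall>\<^sub>F r in at_top. Q (r, 0)" using 3 by (auto elim: eventually_mono)
  ultimately show ?case using E(1) by blast
qed

lemma function_compactum_comb: "function_compactum (comb_functions b)"
proof
  fix \<phi> \<psi> :: "'a \<Rightarrow> real" and h :: "real \<Rightarrow> real" and c
  show "\<exists>B. \<forall>z. \<bar>\<phi> z\<bar> \<le> B" if "\<phi> \<in> comb_functions b" using that by (simp add: comb_functions_def)
  show "(\<lambda>_. c) \<in> comb_functions b" by (auto simp: comb_functions_def)
  assume \<phi>: "\<phi> \<in> comb_functions b"
  then obtain B where B: "\<And>z. \<bar>\<phi> z\<bar> \<le> B" by (auto simp: comb_functions_def)
  {
    assume \<psi>: "\<psi> \<in> comb_functions b"
    then obtain B' where B': "\<And>z. \<bar>\<psi> z\<bar> \<le> B'" by (auto simp: comb_functions_def)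
    have "\<bar>\<phi> z + \<psi> z\<bar> \<le> B + B'" for z using B[of z] B'[of z] by linarith
    then show "(\<lambda>z. \<phi> z + \<psi> z) \<in> comb_functions b"
      using \<phi> \<psi> by (auto simp: comb_functions_def intro!: continuous_intros)
    have "\<bar>\<phi> z * \<psi> z\<bar> \<le> B * B'" for z
      unfolding abs_mult using B[of z] B'[of z] by (intro mult_mono) auto
    then show "(\<lambda>z. \<phi> z * \<psi> z) \<in> comb_functions b"
      using \<phi> \<psi> by (auto simp: comb_functions_def intro!: continuous_intros)
  }
  assume h: "continuous_on UNIV h"
  then have "bounded (h ` {-B..B})"
    by (intro compact_imp_bounded compact_continuous_image) (auto intro: continuous_on_subset)
  then obtain M where "\<forall>t\<in>{-B..B}. \<bar>h t\<bar> \<le> M" unfolding bounded_iff by auto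
  then have "\<bar>h (\<phi> z)\<bar> \<le> M" for z using B[of z] by (simp add: abs_le_iff minus_le_iff)
  then show "(\<lambda>z. h (\<phi> z)) \<in> comb_functions b"
    using \<phi> by (auto simp: comb_functions_def intro!: continuous_on_compose2[OF h])
next
  fix a :: "nat \<Rightarrow> 'a \<Rightarrow> real" and \<phi>
  assume lim: "uniform_limit UNIV a \<phi> sequentially" and a: "\<And>n. a n \<in> comb_functions b"
  have "\<forall>\<^sub>F n in sequentially. \<forall>z. dist (a n z) (\<phi> z) < 1"
    using uniform_limitD[OF lim, of 1] by simp
  \<comment> \<open>A single term within distance 1 of the limit bounds the limit.\<close>
  then obtain n where n: "\<And>z. dist (a n z) (\<phi> z) < 1"
    using eventually_happens'[OF sequentially_bot] by blast
  obtain B where B: "\<And>z. \<bar>a n z\<bar> \<le> B" using a[of n] by (auto simp: comb_functions_def)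
  have "\<bar>\<phi> z\<bar> \<le> B + 1" for z using n[of z] B[of z] unfolding dist_real_def by linarith
  moreover have "continuous_on UNIV (\<lambda>t::real. \<phi> (c t))"
    if "\<And>n. continuous_on UNIV (\<lambda>t. a n (c t))" for c
  proof (rule uniform_limit_theorem[where f = "\<lambda>n t. a n (c t)"])
    show "uniform_limit UNIV (\<lambda>n t. a n (c t)) (\<lambda>t. \<phi> (c t)) sequentially"
      by (rule uniform_limit_compose'[OF lim]) simp
  qed (use that in auto)
  ultimately show "\<phi> \<in> comb_functions b"
    using a by (auto simp: comb_functions_def)
qed

lemma IVT_gap:
  fixes g :: "real \<Rightarrow> real"
  assumes S: "connected S" and g: "continuous_on S g" and gap: "\<And>t. t \<in> S \<Longrightarrow> g t < u \<or> v < g t"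
    and uv: "u \<le> v"
  shows "(\<forall>t\<in>S. g t < u) \<or> (\<forall>t\<in>S. v < g t)"
proof (rule ccontr)
  assume "\<not> ?thesis"
  then obtain t t' where t: "t \<in> S" "t' \<in> S" "g t < u" "v < g t'" using gap by blast
  have "connected (g ` S)" using g S by (rule connected_continuous_image)
  then have "u \<in> g ` S" using t uv by (auto intro: connectedD_interval[of "g ` S" "g t" "g t'"])
  then show False using gap uv by fastforce
qed

text \<open>A tail of the spine is connected, so \<phi> stays on one side of the gap there. Each
  hair outside the exceptional set is connected and meets the spine at \<open>s = 0\<close>, so it
  follows the spine; the set \<open>E\<close> serves again.\<close>

lemma comb_filter_gap:
  assumes \<phi>: "\<phi> \<in> comb_functions b" and gap: "\<forall>\<^sub>F z in comb_filter. \<phi> (b z) < u \<or> v < \<phi> (b z)"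
    and uv: "u \<le> v"
  shows "(\<forall>\<^sub>F z in comb_filter. \<phi> (b z) < u) \<or> (\<forall>\<^sub>F z in comb_filter. v < \<phi> (b z))"
proof -
  have spine: "continuous_on UNIV (\<lambda>r. \<phi> (b (r, 0)))" and hair: "\<And>r. continuous_on UNIV (\<lambda>s. \<phi> (b (r, s)))"
    using \<phi> by (auto simp: comb_functions_def)
  obtain M where M: "\<And>r. r \<ge> M \<Longrightarrow> \<phi> (b (r, 0)) < u \<or> v < \<phi> (b (r, 0))"
    using gap by (auto simp: eventually_comb_filter eventually_at_top_linorder)
  obtain E where E: "countable E"
    "\<And>x. x \<notin> E \<Longrightarrow> \<forall>\<^sub>F r in at_top. sin r = x \<longrightarrow> (\<forall>s. \<phi> (b (r, s)) < u \<or> v < \<phi> (b (r, s)))"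
    using gap by (auto simp: eventually_comb_filter)
  have "(\<forall>r\<in>{M..}. \<phi> (b (r, 0)) < u) \<or> (\<forall>r\<in>{M..}. v < \<phi> (b (r, 0)))"
    using M uv by (intro IVT_gap continuous_on_subset[OF spine]) auto
  then show ?thesis
  proof
    assume low: "\<forall>r\<in>{M..}. \<phi> (b (r, 0)) < u"
    have "\<forall>\<^sub>F r in at_top. sin r = x \<longrightarrow> (\<forall>s. \<phi> (b (r, s)) < u)" if "x \<notin> E" for x
      using E(2)[OF that] eventually_ge_at_top[of M]
    proof eventually_elim
      case (elim r)
      show ?case
      proof
        assume "sin r = x"
        then have "(\<forall>s\<in>UNIV. \<phi> (b (r, s)) < u) \<or> (\<forall>s\<in>UNIV. v < \<phi> (b (r, s)))"
          using elim by (intro IVT_gap[OF _ hair _ uv]) auto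
        moreover have "\<not> v < \<phi> (b (r, 0))" using bspec[OF low, of r] elim(2) uv by simp
        ultimately show "\<forall>s. \<phi> (b (r, s)) < u" by auto
      qed
    qed
    then show ?thesis using E(1) low by (auto simp: eventually_comb_filter eventually_at_top_linorder)
  next
    assume high: "\<forall>r\<in>{M..}. v < \<phi> (b (r, 0))"
    have "\<forall>\<^sub>F r in at_top. sin r = x \<longrightarrow> (\<forall>s. v < \<phi> (b (r, s)))" if "x \<notin> E" for x
      using E(2)[OF that] eventually_ge_at_top[of M]
    proof eventually_elim
      case (elim r)
      show ?case
      proof
        assume "sin r = x"
        then have "(\<forall>s\<in>UNIV. \<phi> (b (r, s)) < u) \<or> (\<forall>s\<in>UNIV. v < \<phi> (b (r, s)))"
          using elim by (intro IVT_gap[OF _ hair _ uv]) auto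
        moreover have "\<not> \<phi> (b (r, 0)) < u" using bspec[OF high, of r] elim(2) uv by simp
        ultimately show "\<forall>s. v < \<phi> (b (r, s))" by auto
      qed
    qed
    then show ?thesis using E(1) high by (auto simp: eventually_comb_filter eventually_at_top_linorder)
  qed
qed

text \<open>For each \<open>n\<close> nearness within \<open>inverse (Suc n)\<close> costs a
  countable set \<open>E n\<close>, and their union is still countable. For a sine value
  \<open>x\<close> outside it and different from \<open>c\<close>, some \<open>n\<close> contradicts
  nearness.\<close>

lemma comb_filter_sin_not_constant:
  assumes near: "\<And>e. e > 0 \<Longrightarrow> \<forall>\<^sub>F z in comb_filter. P z \<longrightarrow> \<bar>sin (fst z) - c\<bar> < e"
    and spine: "\<forall>\<^sub>F r in at_top. \<not> P (r, 0)"
  shows "\<forall>\<^sub>F z in comb_filter. \<not> P z"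
proof -
  define Q where "Q n E \<longleftrightarrow> countable E \<and> (\<forall>x. x \<notin> E \<longrightarrow> (\<forall>\<^sub>F r in at_top. sin r = x \<longrightarrow>
      (\<forall>s. P (r, s) \<longrightarrow> \<bar>sin r - c\<bar> < inverse (Suc n))))" for n E
  have "\<forall>n. \<exists>E. Q n E"
    using near[of "inverse (Suc n)" for n] unfolding Q_def eventually_comb_filter by simp
  from choice[OF this] obtain E where "\<forall>n. Q n (E n)" by (elim exE)
  then have E: "countable (E n)"
    "x \<notin> E n \<Longrightarrow> \<forall>\<^sub>F r in at_top. sin r = x \<longrightarrow> (\<forall>s. P (r, s) \<longrightarrow> \<bar>sin r - c\<bar> < inverse (Suc n))" for n x
    by (simp_all add: Q_def)
  \<comment> \<open>The value \<open>c\<close> joins the exceptional set, because nearness says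
    nothing on hairs with \<open>sin r = c\<close>.\<close>
  have "\<forall>\<^sub>F r in at_top. sin r = x \<longrightarrow> (\<forall>s. \<not> P (r, s))" if x: "x \<notin> insert c (\<Union>n. E n)" for x
  proof -
    obtain n where n: "inverse (real (Suc n)) < \<bar>x - c\<bar>"
      using reals_Archimedean[of "\<bar>x - c\<bar>"] x by auto
    have "\<forall>\<^sub>F r in at_top. sin r = x \<longrightarrow> (\<forall>s. P (r, s) \<longrightarrow> \<bar>sin r - c\<bar> < inverse (Suc n))"
      using E(2)[of x n] x by blast
    then show ?thesis by eventually_elim (use n in fastforce)
  qed
  moreover have "countable (insert c (\<Union>n. E n))" using E(1) by auto
  ultimately show ?thesis unfolding eventually_comb_filter using spine by blast
qed

text \<open>A countable set cannot exhaust \<open>{-1..1}\<close>, and the sine takes any remaining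
  value at arbitrarily large arguments.\<close>

lemma frequently_comb_filter_hair: "\<exists>\<^sub>F z in comb_filter. snd z = s"
proof -
  have False if ev: "\<forall>\<^sub>F z in comb_filter. snd z \<noteq> s"
  proof -
    obtain E where E: "countable E"
      "\<forall>x. x \<notin> E \<longrightarrow> (\<forall>\<^sub>F r::real in at_top. sin r = x \<longrightarrow> (\<forall>t. snd (r, t) \<noteq> s))"
      using ev[unfolded eventually_comb_filter] by (elim conjE exE)
    have "uncountable {-1..1::real}" by (simp add: uncountable_closed_interval)
    then obtain x where x: "x \<in> {-1..1}" "x \<notin> E" using E(1) by (meson countable_subset subsetI)
    obtain N where N: "\<And>r. r \<ge> N \<Longrightarrow> sin r \<noteq> x"
      using E(2)[rule_format, OF x(2)] by (auto simp: eventually_at_top_linorder)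
    \<comment> \<open>Since \<open>arcsin x\<close> is at least -2 and a period is longer than 1,
      shifting by \<open>n\<close> periods moves past \<open>N\<close>.\<close>
    obtain n :: nat where n: "N + 2 \<le> real n" using real_arch_simple by blast
    have "real n * 1 \<le> real n * (2 * pi)" using pi_gt3 by (intro mult_left_mono) auto
    moreover have "- 2 \<le> arcsin x" using arcsin_lbound[of x] x(1) pi_less_4 by simp
    ultimately have "N \<le> arcsin x + real n * (2 * pi)" using n by linarith
    moreover have "sin (arcsin x + real n * (2 * pi)) = x"
      using x(1) sin.plus_of_nat[of "arcsin x" n] by simp
    ultimately show False using N by blast
  qed
  then show ?thesis by (auto simp: frequently_def)
qed

section \<open>Coding the comb by reals and assembling the example\<close>

lemma inj_real_pair: "\<exists>b :: real \<times> real \<Rightarrow> real. inj b"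
proof -
  have "infinite (UNIV :: real set)" by (rule infinite_UNIV_char_0)
  from card_of_Times_same_infinite[OF this]
  obtain b :: "real \<times> real \<Rightarrow> real" where "bij_betw b (UNIV \<times> UNIV) UNIV"
    unfolding card_of_ordIso[symmetric] by blast
  then show ?thesis by (auto simp: bij_betw_def)
qed

theorem mainTheorem1:
  "\<exists>(K :: point topology) (f :: point \<Rightarrow> real).
     compact_space K \<and> Hausdorff_space K \<and> connected_space K \<and> F_space K \<and>
     continuous_map K euclideanreal f \<and>
     K closure_of (Omega K f) \<noteq> topspace K"
proof -
  \<comment> \<open>Coding the comb into the reals puts the cluster set into the type \<open>point\<close>.\<close>
  obtain b :: "real \<times> real \<Rightarrow> real" where b: "inj b" using inj_real_pair by blast
  define \<rho> where "\<rho> z = fst (inv b z)" for z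
  define \<sigma> where "\<sigma> z = snd (inv b z)" for z
  have \<rho>\<sigma> [simp]: "\<rho> (b z) = fst z" "\<sigma> (b z) = snd z" for z
    by (simp_all add: \<rho>_def \<sigma>_def b)
  define f where "f z = sin (\<rho> z)" for z
  \<comment> \<open>This is the distance from the spine along a hair, cut off at 1 to stay
    bounded.\<close>
  define \<tau> where "\<tau> z = min 1 \<bar>\<sigma> z\<bar>" for z
  interpret function_compactum "comb_functions b" "filtermap b comb_filter"
    by (rule function_compactum_comb)
  have f: "f \<in> comb_functions b"
    by (auto simp: comb_functions_def f_def intro!: continuous_intros exI[of _ 1])
  have \<tau>: "\<tau> \<in> comb_functions b"
    by (auto simp: comb_functions_def \<tau>_def intro!: continuous_intros exI[of _ 1])
  let ?K = "top_of_set cluster_set"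
  have "connected cluster_set"
    by (rule connected_cluster_set) (simp only: eventually_filtermap, rule comb_filter_gap, simp_all)
  moreover have "F_space ?K"
  proof (rule F_space_cluster_set)
    fix \<phi> assume "\<phi> \<in> comb_functions b"
    \<comment> \<open>On the spine \<rho> is the coordinate itself and on each hair it is constant,
      so products stay continuous; the clamp restores boundedness.\<close>
    then show "(\<lambda>z. unit_clamp (\<rho> z * \<phi> z)) \<in> comb_functions b"
      by (auto simp: comb_functions_def unit_clamp_def intro!: continuous_intros exI[of _ 1])
  next
    show "filterlim \<rho> at_top (filtermap b comb_filter)"
      unfolding filterlim_at_top eventually_filtermap eventually_comb_filter \<rho>\<sigma> fst_conv
    proof (intro allI conjI exI[of _ "{}"] impI)
      show "\<forall>\<^sub>F r in at_top. Z \<le> r" for Z :: real by (rule eventually_ge_at_top)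
      show "\<forall>\<^sub>F r in at_top. sin r = x \<longrightarrow> (\<forall>s::real. Z \<le> r)" for x Z :: real
        using eventually_ge_at_top[of Z] by eventually_elim simp
    qed simp
  qed
  moreover have "?K closure_of Omega ?K (\<lambda>p. p f) \<noteq> cluster_set"
  proof (rule closure_Omega_neq[OF f \<tau>])
    fix P :: "real \<Rightarrow> bool" and c :: real
    assume near: "\<And>e. e > 0 \<Longrightarrow> \<forall>\<^sub>F z in filtermap b comb_filter. P z \<longrightarrow> \<bar>f z - c\<bar> < e"
      and pos: "\<forall>\<^sub>F z in filtermap b comb_filter. P z \<longrightarrow> \<tau> z > 0"
    \<comment> \<open>As \<tau> vanishes on the spine, positivity of \<tau> rules out
      \<open>P\<close> there.\<close>
    have "\<forall>\<^sub>F r in at_top. \<not> P (b (r, 0))"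
      using pos by (auto simp: eventually_filtermap eventually_comb_filter \<tau>_def)
    then show "\<forall>\<^sub>F z in filtermap b comb_filter. \<not> P z"
      using near comb_filter_sin_not_constant[of "\<lambda>z. P (b z)" c]
      by (simp add: eventually_filtermap f_def)
  next
    show "\<exists>\<^sub>F z in filtermap b comb_filter. 1 \<le> \<tau> z"
      unfolding frequently_filtermap
      by (rule frequently_mono[OF _ frequently_comb_filter_hair[of 1]]) (auto simp: \<tau>_def)
  qed
  moreover have "Hausdorff_space ?K"
    by (intro Hausdorff_space_subtopology Hausdorff_space_euclidean_t2)
  ultimately show ?thesis
    using compact_cluster_set
    by (intro exI[of _ ?K] exI[of _ "\<lambda>p. p f"])
       (simp add: compact_space_subtopology continuous_on_coordinate connected_space_subtopology)
qed

end
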